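(* Let $\mathcal{D}$ be a $2-(v,k,1)$ design with replication number $r=\frac{v-1}{k-1}$, and let $\mathcal{S}$ be an Erdős-Ko-Rado set on $\mathcal{D}$. If $r\geq k^{2}-k+1$, then $|\mathcal{S}|\leq r$. If $r> k^{2}-k+1$ and $|\mathcal{S}|=r$, then $\mathcal{S}$ is a point-pencil.
   Context: A $2-(v,k,1)$ design, with integers $v>k>1$, consists of a set $\mathcal{P}$ of $v$ points together with a set $\mathcal{B}$ of $k$-subsets of $\mathcal{P}$ (blocks) such that any two distinct points are contained in exactly one block. Every point then lies on exactly $r=\frac{v-1}{k-1}$ blocks. An Erdős-Ko-Rado set on a design is a set of pairwise intersecting blocks. A point-pencil is the set of all blocks through a fixed point. *)

theory Defs
  imports Complex_Main
begin

text \<open>Finiteness of \<open>P\<close> and of every block follows from the cardinality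
  conditions, since \<open>v\<close> and \<open>k\<close> are positive.\<close>

definition design :: "nat \<Rightarrow> nat \<Rightarrow> 'a set \<Rightarrow> 'a set set \<Rightarrow> bool" where
  "design v k P B \<longleftrightarrow>
     v > k \<and> k > 1 \<and> card P = v \<and>
     (\<forall>b\<in>B. b \<subseteq> P \<and> card b = k) \<and>
     (\<forall>x\<in>P. \<forall>y\<in>P. x \<noteq> y \<longrightarrow> (\<exists>!b. b \<in> B \<and> x \<in> b \<and> y \<in> b))"

text \<open>The quotient is taken in the reals, so that no rounding and no truncated
  subtraction is involved.\<close>

definition replication_number :: "nat \<Rightarrow> nat \<Rightarrow> real" where
  "replication_number v k = (real v - 1) / (real k - 1)"

definition EKR_set :: "'a set set \<Rightarrow> 'a set set \<Rightarrow> bool" where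
  "EKR_set B S \<longleftrightarrow> S \<subseteq> B \<and> pairwise (\<lambda>b c. b \<inter> c \<noteq> {}) S"

definition point_pencil :: "'a set \<Rightarrow> 'a set set \<Rightarrow> 'a set set \<Rightarrow> bool" where
  "point_pencil P B S \<longleftrightarrow> (\<exists>p\<in>P. S = {b \<in> B. p \<in> b})"

end

theory Submission
  imports Defs
begin

text \<open>If the blocks of \<open>S\<close> have no common point, then every point \<open>p\<close> is missed by some block
  \<open>b \<in> S\<close>. The blocks of \<open>S\<close> through \<open>p\<close> meet \<open>b\<close> in distinct points, so there are at most \<open>k\<close> of
  them. Now fix a block of \<open>S\<close>: every other block of \<open>S\<close> passes through one of its \<open>k\<close> points, each
  of which lies on at most \<open>k - 1\<close> others, so \<open>card S \<le> k * (k - 1) + 1\<close>.\<close>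

lemma designD:
  assumes "design v k P B"
  shows "k < v" "1 < k" "card P = v" "finite P" "finite B"
    and "\<And>b. b \<in> B \<Longrightarrow> b \<subseteq> P" "\<And>b. b \<in> B \<Longrightarrow> card b = k" "\<And>b. b \<in> B \<Longrightarrow> finite b"
    and "\<And>x y. x \<in> P \<Longrightarrow> y \<in> P \<Longrightarrow> x \<noteq> y \<Longrightarrow> \<exists>b\<in>B. x \<in> b \<and> y \<in> b"
    and "\<And>x y b c. b \<in> B \<Longrightarrow> c \<in> B \<Longrightarrow> x \<in> b \<Longrightarrow> x \<in> c \<Longrightarrow> y \<in> b \<Longrightarrow> y \<in> c \<Longrightarrow> x \<noteq> y \<Longrightarrow> b = c"
proof -
  show 1: "k < v" "1 < k" "card P = v"
    using assms by (auto simp: design_def)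
  show 2: "finite P"
    using 1 card_gt_0_iff[of P] by simp
  show 3: "b \<subseteq> P" if "b \<in> B" for b
    using assms that by (auto simp: design_def)
  show "finite B"
    by (rule finite_subset[of _ "Pow P"]) (use 2 3 in auto)
  show "card b = k" if "b \<in> B" for b
    using assms that by (auto simp: design_def)
  show "finite b" if "b \<in> B" for b
    using 2 3 that finite_subset by blast
  have u: "\<exists>!b. b \<in> B \<and> x \<in> b \<and> y \<in> b" if "x \<in> P" "y \<in> P" "x \<noteq> y" for x y
    using assms that by (auto simp: design_def)
  show "\<exists>b\<in>B. x \<in> b \<and> y \<in> b" if "x \<in> P" "y \<in> P" "x \<noteq> y" for x y
    using u[OF that] by blast
  show "b = c" if "b \<in> B" "c \<in> B" "x \<in> b" "x \<in> c" "y \<in> b" "y \<in> c" "x \<noteq> y" for x y b c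
    using u[of x y] 3 that by blast
qed

text \<open>Deleting \<open>p\<close> from the blocks through it leaves sets of size
  \<open>k - 1\<close> that partition the remaining \<open>v - 1\<close> points; double counting
  gives the quotient.\<close>

lemma card_blocks_through_point:
  assumes D: "design v k P B" and p: "p \<in> P"
  shows "real (card {b \<in> B. p \<in> b}) = replication_number v k"
proof -
  note d = designD[OF D]
  let ?D = "{b \<in> B. p \<in> b}"
  have "P - {p} \<subseteq> (\<Union>b\<in>?D. b - {p})"
  proof
    fix x assume "x \<in> P - {p}"
    then obtain b where "b \<in> B" "p \<in> b" "x \<in> b"
      using d(9)[OF p, of x] by blast
    then show "x \<in> (\<Union>b\<in>?D. b - {p})"
      using \<open>x \<in> P - {p}\<close> by blast
  qed
  moreover have "(\<Union>b\<in>?D. b - {p}) \<subseteq> P - {p}"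
    using d(6) by blast
  ultimately have "P - {p} = (\<Union>b\<in>?D. b - {p})"
    by (rule subset_antisym)
  then have "v - 1 = card (\<Union>b\<in>?D. b - {p})"
    using d(3) card_Diff_singleton[OF p] by simp
  also have "\<dots> = (\<Sum>b\<in>?D. card (b - {p}))"
  proof (rule card_UN_disjoint)
    show "finite ?D"
      using d(5) by simp
    show "\<forall>b\<in>?D. finite (b - {p})"
      using d(8) by simp
    \<comment> \<open>Two blocks through \<open>p\<close> that share a further point
      coincide.\<close>
    show "\<forall>b\<in>?D. \<forall>c\<in>?D. b \<noteq> c \<longrightarrow> (b - {p}) \<inter> (c - {p}) = {}"
      using d(10)[where x = p] by blast
  qed
  also have "\<dots> = card ?D * (k - 1)"
    using d(7) by simp
  finally have "real (v - 1) = real (card ?D) * real (k - 1)"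
    by (metis of_nat_mult)
  then show ?thesis
    using d(1,2) by (simp add: replication_number_def of_nat_diff field_simps)
qed

lemma card_UN_le_mult:
  assumes "finite I" "\<And>i. i \<in> I \<Longrightarrow> card (A i) \<le> m"
  shows "card (\<Union>i\<in>I. A i) \<le> card I * m"
  using card_UN_le[OF assms(1), of A] sum_bounded_above[of I "\<lambda>i. card (A i)" m] assms(2)
  by force

lemma EKR_set_card_le_if_no_common_point:
  assumes D: "design v k P B" and S: "EKR_set B S"
    and no_common: "\<And>p. p \<in> P \<Longrightarrow> \<exists>b\<in>S. p \<notin> b"
  shows "card S \<le> k * (k - 1) + 1"
proof (cases "S = {}")
  case False
  note d = designD[OF D]
  have SB: "S \<subseteq> B" and meet: "\<And>b c. b \<in> S \<Longrightarrow> c \<in> S \<Longrightarrow> b \<noteq> c \<Longrightarrow> \<exists>x\<in>b. x \<in> c"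
    using S by (auto simp: EKR_set_def pairwise_def disjoint_iff)
  have fin: "finite S"
    using SB d(5) finite_subset by blast
  have degree: "card {c \<in> S. p \<in> c} \<le> k" if p: "p \<in> P" for p
  proof -
    obtain b where b: "b \<in> S" "p \<notin> b"
      using no_common p by blast
    \<comment> \<open>Since \<open>b\<close> misses \<open>p\<close>, the points \<open>x\<close>
      and \<open>p\<close> are distinct and hence lie together on only one block.\<close>
    have "card {c \<in> S. p \<in> c \<and> x \<in> c} \<le> 1" if "x \<in> b" for x
    proof -
      have "x \<noteq> p" "finite {c \<in> S. p \<in> c \<and> x \<in> c}"
        using b that fin by auto
      then show ?thesis
        using d(10)[where x = p and y = x] SB by (auto simp: card_le_Suc0_iff_eq)
    qed
    then have "card (\<Union>x\<in>b. {c \<in> S. p \<in> c \<and> x \<in> c}) \<le> card b * 1"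
      using d(8) SB b by (intro card_UN_le_mult) auto
    \<comment> \<open>A block through \<open>p\<close> differs from \<open>b\<close>, so the
      intersecting property supplies a point \<open>x\<close> of \<open>b\<close> on it.\<close>
    moreover have "{c \<in> S. p \<in> c} \<subseteq> (\<Union>x\<in>b. {c \<in> S. p \<in> c \<and> x \<in> c})"
      using meet[OF b(1)] b(2) by auto
    moreover have "finite (\<Union>x\<in>b. {c \<in> S. p \<in> c \<and> x \<in> c})"
      by (rule finite_subset[OF _ fin]) auto
    moreover have "card b = k"
      using d(7) SB b by blast
    ultimately show ?thesis
      using card_mono[of "\<Union>x\<in>b. {c \<in> S. p \<in> c \<and> x \<in> c}" "{c \<in> S. p \<in> c}"] by simp
  qed
  obtain b where b: "b \<in> S"
    using False by blast
  have bB: "b \<in> B" "b \<subseteq> P" "finite b" "card b = k"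
    using b SB d(6-8) by auto
  \<comment> \<open>The block \<open>b\<close> is itself one of the at most \<open>k\<close> blocks
    of \<open>S\<close> through \<open>x\<close>, so removing it lowers the bound by one.\<close>
  have "card ({c \<in> S. x \<in> c} - {b}) \<le> k - 1" if "x \<in> b" for x
    using degree[of x] that b bB by (subst card_Diff_singleton) auto
  then have "card (\<Union>x\<in>b. {c \<in> S. x \<in> c} - {b}) \<le> card b * (k - 1)"
    using bB by (intro card_UN_le_mult) auto
  moreover have "S - {b} \<subseteq> (\<Union>x\<in>b. {c \<in> S. x \<in> c} - {b})"
    using meet[OF b] by auto
  moreover have "finite (\<Union>x\<in>b. {c \<in> S. x \<in> c} - {b})"
    by (rule finite_subset[OF _ fin]) auto
  ultimately have "card (S - {b}) \<le> card b * (k - 1)"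
    by (meson card_mono le_trans)
  \<comment> \<open>The summand 1 accounts for \<open>b\<close> itself.\<close>
  then show ?thesis
    using b fin bB(4) by (simp add: card_Diff_singleton)
qed simp

theorem theorem5p1:
  fixes v k :: nat and r :: real
    and P :: "'a set" and B S :: "'a set set"
  defines "r \<equiv> replication_number v k"
  assumes "design v k P B"
    and "EKR_set B S"
  shows "(r \<ge> (real k)^2 - real k + 1 \<longrightarrow> real (card S) \<le> r) \<and>
         (r > (real k)^2 - real k + 1 \<and> real (card S) = r \<longrightarrow> point_pencil P B S)"
\<comment> \<open>With a common point, \<open>S\<close> lies in a pencil of size \<open>r\<close>,
  so the bound is immediate and equality forces the whole pencil. An empty \<open>S\<close> falls
  under this case vacuously, as \<open>P\<close> is nonempty.\<close>
proof (cases "\<exists>p\<in>P. \<forall>b\<in>S. p \<in> b")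
  case True
  then obtain p where p: "p \<in> P" and sub: "S \<subseteq> {b \<in> B. p \<in> b}"
    using assms(3) by (auto simp: EKR_set_def)
  have r: "real (card {b \<in> B. p \<in> b}) = r"
    using card_blocks_through_point[OF assms(2) p] by (simp add: r_def)
  have fin: "finite {b \<in> B. p \<in> b}"
    using designD(5)[OF assms(2)] by simp
  have "real (card S) \<le> r"
    using card_mono[OF fin sub] r by linarith
  moreover have "S = {b \<in> B. p \<in> b}" if "real (card S) = r"
    using card_subset_eq[OF fin sub] that r by linarith
  ultimately show ?thesis
    using p by (auto simp: point_pencil_def)
next
  case False
  then have "card S \<le> k * (k - 1) + 1"
    by (intro EKR_set_card_le_if_no_common_point[OF assms(2,3)]) blast
  then have "real (card S) \<le> real (k * (k - 1) + 1)"
    by (rule of_nat_mono)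
  also have "\<dots> = (real k)^2 - real k + 1"
    using designD(2)[OF assms(2)] by (simp add: of_nat_diff power2_eq_square algebra_simps)
  \<comment> \<open>The bound gives the first claim by transitivity. It also makes
    \<open>card S < r\<close> when \<open>r\<close> strictly exceeds it, so the premises of the
    second claim are contradictory here.\<close>
  finally show ?thesis
    by linarith
qed

end
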